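(* Let $D=(V,A)$ be a digraph with no isolated nodes and let $w:V\to\{0,1,2,\dots\}$ be an integer-valued weight function. The maximum of $\sum_{v\in S}w(v)$ over all sink-stable sets $S$ of $D$ is equal to the minimum total value of a system of circuits and edges of $D$ covering $w$, where the value of a circuit $C$ is $\eta(C)$ and the value of an edge is $1$. Moreover, for a given subset $U\subseteq V$, the maximum cardinality of a sink-stable subset of $U$ is equal to the minimum total value of circuits and edges of $D$ covering $U$.
   Context: Digraphs are finite; parallel and oppositely directed edges are allowed. A directed cut (dicut) of a digraph is the set of edges entering a subset $Z$ of nodes, provided no edge leaves $Z$. A sink node is a node with no leaving edge; a sink set is a set of nodes each of which is a sink. A set of nodes is sink-stable in $D$ if there are pairwise edge-disjoint dicuts of $D$ such that, after reversing the orientation of all edges of these dicuts, the set becomes a sink set. A circuit $C$ of $D$ is a subdigraph whose underlying undirected graph is a circuit (connected with every degree equal to 2; its edges may be oriented arbitrarily, and two edges joining the same two nodes form a circuit); $V(C)$ is its node-set. Traversing $C$ in one of its two directions, each edge is forward or backward according to whether it is traversed along or against its orientation; $\eta(C)$ is the minimum of the number of forward edges and the number of backward edges of $C$. A system of circuits and edges is a finite collection in which members may be repeated (non-negative integer multiplicities); its total value is the sum of the values of its members counted with multiplicity. It covers $w$ if each node $v\in V$ belongs to at least $w(v)$ members (counted with multiplicity), where an edge contains its two end-nodes. It covers $U$ if each node of $U$ belongs to at least one member. *)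

theory Defs
  imports "Graph_Theory.Digraph_Component" "HOL-Library.Multiset"
begin

text \<open>
  Digraphs are the finite multi-digraphs of \<^locale>\<open>fin_digraph\<close>: parallel and oppositely
  directed arcs are allowed. Loops are not excluded; a loop is a circuit with one node (the loop
  counts twice in its degree) of value 0, and it is never contained in a dicut.
\<close>

definition no_isolated_nodes :: "('a, 'b) pre_digraph \<Rightarrow> bool" where
  "no_isolated_nodes G \<longleftrightarrow> (\<forall>v \<in> verts G. \<exists>e \<in> arcs G. v = tail G e \<or> v = head G e)"

definition dicut :: "('a, 'b) pre_digraph \<Rightarrow> 'b set \<Rightarrow> bool" where
  "dicut G X \<longleftrightarrow>
     (\<exists>Z \<subseteq> verts G.
        X = {e \<in> arcs G. tail G e \<notin> Z \<and> head G e \<in> Z} \<and>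
        \<not> (\<exists>e \<in> arcs G. tail G e \<in> Z \<and> head G e \<notin> Z))"

definition reverse_arcs :: "('a, 'b) pre_digraph \<Rightarrow> 'b set \<Rightarrow> ('a, 'b) pre_digraph" where
  "reverse_arcs G X =
     G\<lparr> tail := (\<lambda>e. if e \<in> X then head G e else tail G e),
        head := (\<lambda>e. if e \<in> X then tail G e else head G e) \<rparr>"

definition sink_set :: "('a, 'b) pre_digraph \<Rightarrow> 'a set \<Rightarrow> bool" where
  "sink_set G S \<longleftrightarrow> S \<subseteq> verts G \<and> (\<forall>v \<in> S. out_arcs G v = {})"

definition sink_stable :: "('a, 'b) pre_digraph \<Rightarrow> 'a set \<Rightarrow> bool" where
  "sink_stable G S \<longleftrightarrow>
     (\<exists>F. (\<forall>X \<in> F. dicut G X) \<and> pairwise disjnt F \<and> sink_set (reverse_arcs G (\<Union>F)) S)"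

text \<open>
  \<^const>\<open>connected\<close> is connectedness of the underlying undirected graph (which includes
  nonemptiness), and the undirected degree of a node is its in-degree plus its out-degree.
\<close>

definition circuit :: "('a, 'b) pre_digraph \<Rightarrow> ('a, 'b) pre_digraph \<Rightarrow> bool" where
  "circuit G C \<longleftrightarrow>
     subgraph C G \<and> connected C \<and> (\<forall>v \<in> verts C. in_degree C v + out_degree C v = 2)"

text \<open>
  A traversal of a circuit is the cyclic list of its arcs, each arc being marked \<^const>\<open>True\<close> if
  it is passed along its orientation (forward) and \<^const>\<open>False\<close> if against it (backward).
\<close>

fun step_from :: "('a, 'b) pre_digraph \<Rightarrow> 'b \<times> bool \<Rightarrow> 'a" where
  "step_from C (e, fwd) = (if fwd then tail C e else head C e)"

fun step_to :: "('a, 'b) pre_digraph \<Rightarrow> 'b \<times> bool \<Rightarrow> 'a" where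
  "step_to C (e, fwd) = (if fwd then head C e else tail C e)"

definition traversal :: "('a, 'b) pre_digraph \<Rightarrow> ('b \<times> bool) list \<Rightarrow> bool" where
  "traversal C p \<longleftrightarrow>
     distinct (map fst p) \<and> set (map fst p) = arcs C \<and>
     (\<forall>i < length p. step_to C (p ! i) = step_from C (p ! (Suc i mod length p)))"

definition num_forward :: "('b \<times> bool) list \<Rightarrow> nat" where
  "num_forward p = length (filter snd p)"

definition num_backward :: "('b \<times> bool) list \<Rightarrow> nat" where
  "num_backward p = length (filter (\<lambda>s. \<not> snd s) p)"

text \<open>
  Traversals of one circuit differ only in the starting point and the direction, and changing
  the direction swaps forward and backward arcs (for a loop, each mark gives a traversal). So the
  minimum below has the same value for every traversal, and the choice of traversal made by
  \<open>LEAST\<close> is immaterial.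
\<close>

definition eta :: "('a, 'b) pre_digraph \<Rightarrow> nat" where
  "eta C = (LEAST k. \<exists>p. traversal C p \<and> k = min (num_forward p) (num_backward p))"

text \<open>
  A system of circuits and arcs is a pair of a multiset of circuits and a multiset of arcs.
\<close>

type_synonym ('a, 'b) system = "('a, 'b) pre_digraph multiset \<times> 'b multiset"

definition is_system :: "('a, 'b) pre_digraph \<Rightarrow> ('a, 'b) system \<Rightarrow> bool" where
  "is_system G = (\<lambda>(Cs, Es). (\<forall>C \<in># Cs. circuit G C) \<and> set_mset Es \<subseteq> arcs G)"

definition system_value :: "('a, 'b) system \<Rightarrow> nat" where
  "system_value = (\<lambda>(Cs, Es). (\<Sum>C \<in># Cs. eta C) + size Es)"

definition num_containing :: "('a, 'b) pre_digraph \<Rightarrow> ('a, 'b) system \<Rightarrow> 'a \<Rightarrow> nat" where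
  "num_containing G = (\<lambda>(Cs, Es) v.
     size {#C \<in># Cs. v \<in> verts C#} + size {#e \<in># Es. v = tail G e \<or> v = head G e#})"

definition covers_weight :: "('a, 'b) pre_digraph \<Rightarrow> ('a, 'b) system \<Rightarrow> ('a \<Rightarrow> nat) \<Rightarrow> bool" where
  "covers_weight G \<S> w \<longleftrightarrow> (\<forall>v \<in> verts G. w v \<le> num_containing G \<S> v)"

definition covers_set :: "('a, 'b) pre_digraph \<Rightarrow> ('a, 'b) system \<Rightarrow> 'a set \<Rightarrow> bool" where
  "covers_set G \<S> U \<longleftrightarrow> (\<forall>v \<in> U. 1 \<le> num_containing G \<S> v)"

definition is_maximum :: "nat set \<Rightarrow> nat \<Rightarrow> bool" where
  "is_maximum M m \<longleftrightarrow> m \<in> M \<and> (\<forall>x \<in> M. x \<le> m)"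

definition is_minimum :: "nat set \<Rightarrow> nat \<Rightarrow> bool" where
  "is_minimum M m \<longleftrightarrow> m \<in> M \<and> (\<forall>x \<in> M. m \<le> x)"

end

theory Submission
  imports Defs
begin

text \<open>
  The theorem is linear programming duality for a min-cost circulation problem whose integrality
  is automatic.

  Reversing disjoint dicuts that are entered at the node sets \<open>Z\<^sub>1, Z\<^sub>2, \<dots>\<close> amounts to choosing the
  integer potential \<open>\<pi> v\<close> = number of the \<open>Z\<^sub>i\<close> containing \<open>v\<close>; it grows by 0 or 1 along each arc,
  and the reversed arcs are those where it grows by 1. Hence \<open>S\<close> is sink-stable iff some integer
  \<open>\<pi>\<close> satisfies \<open>\<pi> u + [u \<in> S] \<le> \<pi> v\<close> and \<open>\<pi> v + [v \<in> S] \<le> \<pi> u + 1\<close> for every arc from \<open>u\<close> to \<open>v\<close>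
  (\<open>sink_stable_iff_potential\<close>). Writing \<open>\<pi>' v = \<pi> v + [v \<in> S]\<close>, these are upper bounds on
  differences of node potentials in the digraph in which each node \<open>v\<close> is split into a copy
  carrying \<open>\<pi> v\<close> and a copy carrying \<open>\<pi>' v\<close>, and the objective is \<open>\<Sum>v. w v * (\<pi>' v - \<pi> v)\<close>.

  The dual is therefore a circulation problem: each arc of \<open>D\<close> may be traversed forward at cost 0
  or backward at cost 1, and at least \<open>w v\<close> units must pass through each node \<open>v\<close>. An integral
  circulation of minimum cost and a matching integral potential exist because a residual digraph
  without negative closed walks has shortest-walk potentials
  (\<open>min_cost_circulation_duality\<close>). An integral circulation splits into closed walks that repeat no
  node, and such a walk either passes one arc to and fro, which is an edge of value 1, or is a
  circuit \<open>C\<close>, whose cost, the number of its backward arcs, is at least \<open>\<eta>(C)\<close>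
  (\<open>circulation_decomposition\<close>). Thus some system covering \<open>w\<close> costs at most the weight of some
  sink-stable set (\<open>strong_duality\<close>).

  Conversely, adding up the inequalities for \<open>\<pi>\<close> around a circuit \<open>C\<close>, in either direction, bounds
  the number of its nodes in \<open>S\<close> by the number of backward and of forward arcs, hence by \<open>\<eta>(C)\<close>
  (\<open>weak_duality\<close>). The value of \<^const>\<open>eta\<close> is determined only by traversals, so this needs the
  fact that every connected 2-regular subgraph has one (\<open>circuit_has_traversal\<close>).

  The statement on covering \<open>U\<close> is the case where \<open>w\<close> is the indicator of \<open>U\<close>, as subsets of
  sink-stable sets are sink-stable.
\<close>

section \<open>Walks\<close>

text \<open>
  Walks are needed in three digraphs: the residual digraph of a circulation, the doubled digraph of
  forward and backward steps, and a circuit with its steps. Hence the two end functions are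
  parameters.
\<close>

fun walk_betw :: "('s \<Rightarrow> 'n) \<Rightarrow> ('s \<Rightarrow> 'n) \<Rightarrow> 'n \<Rightarrow> 's list \<Rightarrow> 'n \<Rightarrow> bool" where
  "walk_betw src dst x [] y \<longleftrightarrow> x = y"
| "walk_betw src dst x (s # p) y \<longleftrightarrow> src s = x \<and> walk_betw src dst (dst s) p y"

lemma walk_betw_append:
  "walk_betw src dst x (p @ q) z \<longleftrightarrow> (\<exists>y. walk_betw src dst x p y \<and> walk_betw src dst y q z)"
  by (induction p arbitrary: x) auto

lemma walk_betw_telescope:
  fixes \<phi> :: "'n \<Rightarrow> int"
  shows "walk_betw src dst x p y \<Longrightarrow> (\<Sum>s\<leftarrow>p. \<phi> (src s) - \<phi> (dst s)) = \<phi> x - \<phi> y"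
  by (induction p arbitrary: x) auto

lemma walk_betw_conv_nth:
  "p \<noteq> [] \<Longrightarrow> walk_betw src dst x p y \<longleftrightarrow>
     src (p ! 0) = x \<and> dst (last p) = y \<and> (\<forall>i. Suc i < length p \<longrightarrow> dst (p ! i) = src (p ! Suc i))"
proof (induction p arbitrary: x)
  case (Cons s p)
  note IH = Cons.IH[of "dst s"]
  show ?case
  proof (cases p)
    case Nil then show ?thesis by auto
  next
    case p: (Cons s' p')
    have steps: "(\<forall>i. Suc i < length (s # p) \<longrightarrow> dst ((s # p) ! i) = src ((s # p) ! Suc i)) \<longleftrightarrow>
      dst s = src s' \<and> (\<forall>i. Suc i < length p \<longrightarrow> dst (p ! i) = src (p ! Suc i))"
      using All_less_Suc2[of "length p'" "\<lambda>i. dst ((s # p) ! i) = src ((s # p) ! Suc i)"] p by simp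
    have ends: "(s # p) ! 0 = s" "last (s # p) = last p" "p ! 0 = s'" "p \<noteq> []"
      using p by auto
    show ?thesis
      unfolding steps walk_betw.simps(2) IH[OF ends(4)] unfolding ends eq_commute[of "src s'"] by blast
  qed
qed simp

text \<open>
  The cyclic successor condition is the form in which \<^const>\<open>traversal\<close> is stated.
\<close>

lemma closed_walk_conv_nth:
  assumes "p \<noteq> []"
  shows "(\<exists>x. walk_betw src dst x p x) \<longleftrightarrow>
         (\<forall>i<length p. dst (p ! i) = src (p ! (Suc i mod length p)))" (is "?L \<longleftrightarrow> ?R")
proof
  assume ?L
  show ?R
  proof (intro allI impI)
    fix i assume i: "i < length p"
    show "dst (p ! i) = src (p ! (Suc i mod length p))"
    proof (cases "Suc i < length p")
      case True
      with \<open>?L\<close> assms show ?thesis by (auto simp: walk_betw_conv_nth)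
    next
      case False
      with i have "Suc i = length p" by simp
      then have "i = length p - 1" "Suc i mod length p = 0" by auto
      with \<open>?L\<close> assms show ?thesis
        by (auto simp: walk_betw_conv_nth last_conv_nth)
    qed
  qed
next
  assume R: ?R
  have "dst (last p) = src (p ! 0)"
    using R[rule_format, of "length p - 1"] assms by (simp add: last_conv_nth)
  moreover have "dst (p ! i) = src (p ! Suc i)" if "Suc i < length p" for i
    using R[rule_format, of i] that by simp
  ultimately show ?L using assms by (auto simp: walk_betw_conv_nth)
qed

text \<open>
  In a closed walk each step has a cyclic successor, which leaves from where the step arrives.
\<close>

lemma closed_walk_dst_in_src:
  assumes "walk_betw src dst x q x" "s \<in> set q"
  shows "dst s \<in> src ` set q"
proof -
  obtain q1 q2 where q: "q = q1 @ s # q2" using assms(2) by (meson split_list)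
  \<comment> \<open>Rotate the closed walk so that the step after \<open>s\<close> comes first.\<close>
  have w: "walk_betw src dst (dst s) (q2 @ q1) (src s)" using assms(1) by (auto simp: q walk_betw_append)
  then have "walk_betw src dst (dst s) (q2 @ q1 @ [s]) (dst s)" by (auto simp: walk_betw_append)
  then have "src (hd (q2 @ q1 @ [s])) = dst s" by (cases "q2 @ q1 @ [s]") auto
  moreover have "hd (q2 @ q1 @ [s]) \<in> set q"
    using hd_in_set[of "q2 @ q1 @ [s]"] by (auto simp: q)
  ultimately show ?thesis by force
qed

section \<open>Potentials\<close>

text \<open>
  If a step \<open>s\<close> occurs twice, the part from its first to just before its second occurrence is a
  closed walk. By induction it costs at least as much as some closed walk without repeated steps,
  so its cost is nonnegative and it may be cut out. Assuming nonnegativity only for closed walks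
  with distinct steps matters: pushing one unit of flow along such a walk changes the flow on every
  arc by at most 1.
\<close>

lemma walk_betw_shorten_to_distinct:
  fixes cost :: "'s \<Rightarrow> int"
  assumes nonneg: "\<And>x p. walk_betw src dst x p x \<Longrightarrow> set p \<subseteq> R \<Longrightarrow> distinct p \<Longrightarrow> 0 \<le> (\<Sum>s\<leftarrow>p. cost s)"
  assumes "walk_betw src dst x p y" "set p \<subseteq> R"
  shows "\<exists>q. walk_betw src dst x q y \<and> set q \<subseteq> R \<and> distinct q \<and> (\<Sum>s\<leftarrow>q. cost s) \<le> (\<Sum>s\<leftarrow>p. cost s)"
  using assms(2,3)
proof (induction p arbitrary: x y rule: length_induct)
  case (1 p)
  show ?case
  proof (cases "distinct p")
    case True
    with 1 show ?thesis by blast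
  next
    case False
    then obtain p1 s p2 p3 where p: "p = p1 @ [s] @ p2 @ [s] @ p3"
      using not_distinct_decomp by blast
    from 1(2) have w: "walk_betw src dst (src s) (s # p2) (src s)" "walk_betw src dst x (p1 @ s # p3) y"
      unfolding p by (auto simp: walk_betw_append)
    have "\<exists>q. walk_betw src dst (src s) q (src s) \<and> set q \<subseteq> R \<and> distinct q
            \<and> (\<Sum>s\<leftarrow>q. cost s) \<le> (\<Sum>s\<leftarrow>s # p2. cost s)"
      by (rule 1(1)[rule_format, OF _ w(1)]) (use 1(3) in \<open>auto simp: p\<close>)
    then have "0 \<le> (\<Sum>s\<leftarrow>s # p2. cost s)"
      using nonneg by (meson order_trans)
    moreover have "\<exists>q. walk_betw src dst x q y \<and> set q \<subseteq> R \<and> distinct q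
            \<and> (\<Sum>s\<leftarrow>q. cost s) \<le> (\<Sum>s\<leftarrow>p1 @ s # p3. cost s)"
      by (rule 1(1)[rule_format, OF _ w(2)]) (use 1(3) in \<open>auto simp: p\<close>)
    ultimately show ?thesis unfolding p by fastforce
  qed
qed

text \<open>
  The potential of \<open>x\<close> is the least cost of a walk without repeated steps that starts at \<open>x\<close>;
  there are finitely many of them, including the empty one. Prepending a step \<open>s\<close> to an optimal
  walk gives the inequality for \<open>s\<close> once repeated steps have been removed.
\<close>

lemma feasible_potential:
  fixes cost :: "'s \<Rightarrow> int"
  assumes "finite R"
  assumes nonneg: "\<And>x p. walk_betw src dst x p x \<Longrightarrow> set p \<subseteq> R \<Longrightarrow> distinct p \<Longrightarrow> 0 \<le> (\<Sum>s\<leftarrow>p. cost s)"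
  obtains \<pi> :: "'n \<Rightarrow> int" where "\<And>s. s \<in> R \<Longrightarrow> \<pi> (src s) \<le> \<pi> (dst s) + cost s"
proof -
  define Q where "Q x = {q. set q \<subseteq> R \<and> distinct q \<and> (\<exists>y. walk_betw src dst x q y)}" for x
  define \<pi> where "\<pi> x = Min ((\<lambda>q. \<Sum>s\<leftarrow>q. cost s) ` Q x)" for x
  have fin: "finite (Q x)" for x
    by (rule finite_subset[OF _ finite_subset_distinct[OF \<open>finite R\<close>]]) (auto simp: Q_def)
  have ne: "Q x \<noteq> {}" for x
    by (auto simp: Q_def intro!: exI[of _ "[]"])
  show thesis
  proof (rule that[of \<pi>])
    fix s assume s: "s \<in> R"
    have "\<pi> (dst s) \<in> (\<lambda>q. \<Sum>s\<leftarrow>q. cost s) ` Q (dst s)"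
      unfolding \<pi>_def by (rule Min_in) (use fin ne in auto)
    then obtain q y where q: "set q \<subseteq> R" "walk_betw src dst (dst s) q y"
      "\<pi> (dst s) = (\<Sum>s\<leftarrow>q. cost s)" by (auto simp: Q_def)
    obtain r where r: "walk_betw src dst (src s) r y" "set r \<subseteq> R" "distinct r"
      "(\<Sum>s\<leftarrow>r. cost s) \<le> (\<Sum>s\<leftarrow>s # q. cost s)"
      using walk_betw_shorten_to_distinct[of src dst R cost "src s" "s # q" y] nonneg q s by auto
    then have "\<pi> (src s) \<le> (\<Sum>s\<leftarrow>r. cost s)"
      unfolding \<pi>_def using fin by (intro Min_le) (auto simp: Q_def)
    with r(4) q(3) show "\<pi> (src s) \<le> \<pi> (dst s) + cost s" by simp
  qed
qed

section \<open>Circulations of minimum cost\<close>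

text \<open>
  Flow conservation is expressed by orthogonality to all potential differences. Taking the indicator
  of a node for \<open>\<phi>\<close> gives the balance at this node; in this form sums over circulations telescope
  directly.
\<close>

definition circulation :: "('e \<Rightarrow> 'n) \<Rightarrow> ('e \<Rightarrow> 'n) \<Rightarrow> 'e set \<Rightarrow> ('e \<Rightarrow> int) \<Rightarrow> bool" where
  "circulation t h E f \<longleftrightarrow> (\<forall>\<phi>::'n \<Rightarrow> int. (\<Sum>e\<in>E. f e * (\<phi> (t e) - \<phi> (h e))) = 0)"

text \<open>
  The residual digraph has an arc \<open>(e, True)\<close> along \<open>e\<close> and an arc \<open>(e, False)\<close> against \<open>e\<close>. Its heads
  are obtained by exchanging the arguments \<open>t\<close> and \<open>h\<close>.
\<close>

definition residual_src :: "('e \<Rightarrow> 'n) \<Rightarrow> ('e \<Rightarrow> 'n) \<Rightarrow> 'e \<times> bool \<Rightarrow> 'n" where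
  "residual_src t h s = (if snd s then t (fst s) else h (fst s))"

definition direction_sign :: "bool \<Rightarrow> int" where "direction_sign b = (if b then 1 else - 1)"

lemma sum_signed:
  fixes g :: "'e \<Rightarrow> int"
  assumes "finite E" "Q \<subseteq> E \<times> UNIV"
  shows "(\<Sum>e\<in>E. (of_bool ((e, True) \<in> Q) - of_bool ((e, False) \<in> Q)) * g e)
       = (\<Sum>s\<in>Q. direction_sign (snd s) * g (fst s))"
proof -
  have "(\<Sum>s\<in>Q. direction_sign (snd s) * g (fst s))
      = (\<Sum>s\<in>E \<times> UNIV. of_bool (s \<in> Q) * (direction_sign (snd s) * g (fst s)))"
    using assms by (intro sum.mono_neutral_cong_left) auto
  also have "\<dots> = (\<Sum>e\<in>E. \<Sum>b\<in>UNIV. of_bool ((e, b) \<in> Q) * (direction_sign b * g e))"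
    by (simp only: sum.cartesian_product case_prod_unfold fst_conv snd_conv prod.collapse)
  also have "\<dots> = (\<Sum>e\<in>E. (of_bool ((e, True) \<in> Q) - of_bool ((e, False) \<in> Q)) * g e)"
    by (intro sum.cong) (auto simp: UNIV_bool direction_sign_def algebra_simps)
  finally show ?thesis by simp
qed

text \<open>
  Let \<open>f\<close> be an integral circulation of minimum cost above the lower bounds. Pushing one unit along a
  closed walk with distinct steps of the residual digraph keeps the circulation above the bounds, so
  such a walk has nonnegative cost, and a feasible potential \<open>\<pi>\<close> of the residual costs exists. It
  satisfies complementary slackness: the reduced cost \<open>c e - (\<pi> (t e) - \<pi> (h e))\<close> vanishes wherever
  \<open>f e > l e\<close>. The final equation is then obtained by replacing \<open>f\<close> by \<open>l\<close> in the sum of reduced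
  costs, to which \<open>\<pi>\<close> contributes nothing because \<open>f\<close> is a circulation.
\<close>

lemma min_cost_circulation_duality:
  fixes c l :: "'e \<Rightarrow> int" and t h :: "'e \<Rightarrow> 'n"
  assumes "finite E"
    and c: "\<And>e. e \<in> E \<Longrightarrow> 0 \<le> c e" and l: "\<And>e. e \<in> E \<Longrightarrow> 0 \<le> l e"
    and feasible: "circulation t h E f0" "\<And>e. e \<in> E \<Longrightarrow> l e \<le> f0 e"
  obtains f \<pi> where "circulation t h E f" "\<And>e. e \<in> E \<Longrightarrow> l e \<le> f e"
    "\<And>e. e \<in> E \<Longrightarrow> \<pi> (t e) - \<pi> (h e) \<le> c e"
    "(\<Sum>e\<in>E. f e * c e) = (\<Sum>e\<in>E. l e * (c e - (\<pi> (t e) - \<pi> (h e))))"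
proof -
  define feas where "feas f \<longleftrightarrow> circulation t h E f \<and> (\<forall>e\<in>E. l e \<le> f e)" for f
  define cost where "cost f = (\<Sum>e\<in>E. f e * c e)" for f
  have cost_nonneg: "0 \<le> cost f" if "feas f" for f
    using that c l by (auto simp: cost_def feas_def intro!: sum_nonneg mult_nonneg_nonneg intro: order_trans)
  have "feas f0" using feasible by (simp add: feas_def)
  then obtain f where f: "feas f" and "\<And>g. feas g \<Longrightarrow> nat (cost f) \<le> nat (cost g)"
    using ex_has_least_nat[of feas f0 "\<lambda>f. nat (cost f)"] by blast
  then have opt: "cost f \<le> cost g" if "feas g" for g
    using that cost_nonneg by fastforce
  define R where "R = {(e, b). e \<in> E \<and> (b \<or> l e < f e)}"
  define src where "src = residual_src t h"
  define dst where "dst = residual_src h t"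
  define rc where "rc s = direction_sign (snd s) * c (fst s)" for s :: "'e \<times> bool"
  have "finite R"
    by (rule finite_subset[of _ "E \<times> UNIV"]) (use \<open>finite E\<close> in \<open>auto simp: R_def\<close>)
  moreover have "0 \<le> (\<Sum>s\<leftarrow>p. rc s)" if w: "walk_betw src dst x p x" "set p \<subseteq> R" "distinct p" for x p
  proof -
    \<comment> \<open>\<open>d\<close> is the change of the flow when one unit is pushed along \<open>p\<close>.\<close>
    define d where "d e = (of_bool ((e, True) \<in> set p) - of_bool ((e, False) \<in> set p) :: int)" for e
    have sub: "set p \<subseteq> E \<times> UNIV" using w(2) by (auto simp: R_def)
    have "(\<Sum>e\<in>E. d e * (\<phi> (t e) - \<phi> (h e))) = 0" for \<phi> :: "'n \<Rightarrow> int"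
    proof -
      have "(\<Sum>e\<in>E. d e * (\<phi> (t e) - \<phi> (h e)))
          = (\<Sum>s\<in>set p. direction_sign (snd s) * (\<phi> (t (fst s)) - \<phi> (h (fst s))))"
        unfolding d_def by (rule sum_signed[OF \<open>finite E\<close> sub])
      also have "\<dots> = (\<Sum>s\<in>set p. \<phi> (src s) - \<phi> (dst s))"
        by (intro sum.cong) (auto simp: src_def dst_def residual_src_def direction_sign_def)
      also have "\<dots> = (\<Sum>s\<leftarrow>p. \<phi> (src s) - \<phi> (dst s))"
        using w(3) by (simp add: sum_list_distinct_conv_sum_set)
      finally show ?thesis using walk_betw_telescope[OF w(1), of \<phi>] by simp
    qed
    then have "circulation t h E (\<lambda>e. f e + d e)"
      using f by (simp add: feas_def circulation_def distrib_right sum.distrib)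
    moreover have "l e \<le> f e + d e" if "e \<in> E" for e
      using f w(2) that by (auto simp: feas_def d_def R_def)
    ultimately have "cost f \<le> cost (\<lambda>e. f e + d e)"
      by (intro opt) (simp add: feas_def)
    also have "\<dots> = cost f + (\<Sum>e\<in>E. d e * c e)"
      by (simp add: cost_def distrib_right sum.distrib)
    also have "(\<Sum>e\<in>E. d e * c e) = (\<Sum>s\<in>set p. rc s)"
      unfolding d_def rc_def by (rule sum_signed[OF \<open>finite E\<close> sub])
    also have "\<dots> = (\<Sum>s\<leftarrow>p. rc s)"
      using w(3) by (simp add: sum_list_distinct_conv_sum_set)
    finally show ?thesis by simp
  qed
  ultimately obtain \<pi> :: "'n \<Rightarrow> int" where \<pi>: "\<And>s. s \<in> R \<Longrightarrow> \<pi> (src s) \<le> \<pi> (dst s) + rc s"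
    using feasible_potential[of R src dst rc] by metis
  have le: "\<pi> (t e) - \<pi> (h e) \<le> c e" if "e \<in> E" for e
    using \<pi>[of "(e, True)"] that
    by (simp add: R_def src_def dst_def rc_def residual_src_def direction_sign_def)
  have tight: "\<pi> (t e) - \<pi> (h e) = c e" if "e \<in> E" "l e < f e" for e
    using \<pi>[of "(e, False)"] le[of e] that
    by (simp add: R_def src_def dst_def rc_def residual_src_def direction_sign_def)
  have "(\<Sum>e\<in>E. f e * c e) = (\<Sum>e\<in>E. f e * (c e - (\<pi> (t e) - \<pi> (h e)))) + (\<Sum>e\<in>E. f e * (\<pi> (t e) - \<pi> (h e)))"
    by (simp flip: sum.distrib add: algebra_simps)
  also have "(\<Sum>e\<in>E. f e * (\<pi> (t e) - \<pi> (h e))) = 0"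
    using f by (simp add: feas_def circulation_def)
  also have "(\<Sum>e\<in>E. f e * (c e - (\<pi> (t e) - \<pi> (h e)))) = (\<Sum>e\<in>E. l e * (c e - (\<pi> (t e) - \<pi> (h e))))"
  proof (intro sum.cong refl)
    fix e assume "e \<in> E"
    with f have "l e \<le> f e" by (simp add: feas_def)
    then show "f e * (c e - (\<pi> (t e) - \<pi> (h e))) = l e * (c e - (\<pi> (t e) - \<pi> (h e)))"
      using tight[OF \<open>e \<in> E\<close>] by (cases "l e = f e") auto
  qed
  finally show thesis
    using that[of f \<pi>] f le by (simp add: feas_def)
qed

text \<open>
  By conservation, the head of an arc carrying flow is the tail of another such arc. So a longest
  walk through arcs carrying flow that leaves no node twice must be extendible to a node that
  it has left before, and it closes up there.
\<close>

lemma circulation_contains_simple_closed_walk: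
  assumes "finite E" and circ: "circulation t h E (\<lambda>e. int (f e))" and "e0 \<in> E" "0 < f e0"
  obtains x q where "q \<noteq> []" "walk_betw t h x q x" "distinct (map t q)" "set q \<subseteq> {e \<in> E. 0 < f e}"
proof -
  define T where "T = {e \<in> E. 0 < f e}"
  have "finite T" "e0 \<in> T" using assms by (auto simp: T_def)
  have succ: "\<exists>s'\<in>T. t s' = h s" if "s \<in> T" for s
  proof (rule ccontr)
    assume no: "\<not> ?thesis"
    have "(\<Sum>e\<in>E. int (f e) * (of_bool (t e = h s) - of_bool (h e = h s))) = 0"
      using circ[unfolded circulation_def, rule_format, of "\<lambda>v. of_bool (v = h s)"] by simp
    moreover have "(\<Sum>e\<in>E. int (f e) * (of_bool (t e = h s) - of_bool (h e = h s)))
        = (\<Sum>e\<in>E. - (int (f e) * of_bool (h e = h s)))"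
      using no by (intro sum.cong) (auto simp: T_def)
    ultimately have "(\<Sum>e\<in>E. int (f e) * of_bool (h e = h s)) = 0" by (simp add: sum_negf)
    then have "int (f s) * of_bool (h s = h s) = 0"
      using \<open>finite E\<close> that by (subst (asm) sum_nonneg_eq_0_iff) (auto simp: T_def)
    with that show False by (simp add: T_def)
  qed
  define P where "P q \<longleftrightarrow> q \<noteq> [] \<and> set q \<subseteq> T \<and> distinct (map t q) \<and> (\<exists>x y. walk_betw t h x q y)" for q
  have "P [e0]" using \<open>e0 \<in> T\<close> by (auto simp: P_def)
  moreover have "length q \<le> card T" if "P q" for q
    using that \<open>finite T\<close> by (auto simp: P_def distinct_map card_mono simp flip: distinct_card)
  ultimately obtain q where q: "P q" and longest: "\<And>r. P r \<Longrightarrow> length r \<le> length q"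
    using ex_has_greatest_nat[of P "[e0]" length "Suc (card T)"] by (metis le_imp_less_Suc)
  from q obtain x y where w: "walk_betw t h x q y" by (auto simp: P_def)
  with q have y: "y = h (last q)" by (auto simp: P_def walk_betw_conv_nth)
  have "last q \<in> T" using q last_in_set[of q] unfolding P_def by blast
  then obtain s where s: "s \<in> T" "t s = y"
    using succ y by auto
  have "\<not> P (q @ [s])" using longest[of "q @ [s]"] by auto
  moreover have "walk_betw t h x (q @ [s]) (h s)" using w s by (auto simp: walk_betw_append)
  ultimately have "t s \<in> t ` set q"
    using q s by (auto simp: P_def)
  then obtain a where a: "a \<in> set q" "t a = y" using s by auto
  then obtain q1 q2 where q12: "q = q1 @ a # q2" by (meson split_list)
  show thesis
  proof (rule that)
    show "walk_betw t h y (a # q2) y" using w a by (auto simp: q12 walk_betw_append)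
    show "distinct (map t (a # q2))" "set (a # q2) \<subseteq> {e \<in> E. 0 < f e}"
      using q by (auto simp: P_def q12 T_def)
  qed simp
qed

section \<open>Circuits and their traversals\<close>

lemma step_simps:
  "step_from C s = (if snd s then tail C (fst s) else head C (fst s))"
  "step_to C s = (if snd s then head C (fst s) else tail C (fst s))"
  by (cases s; simp)+

text \<open>
  Both uses of connectivity, deriving it and exploiting it, concern sets of nodes that no arc leaves
  or enters, so this form replaces reachability in the symmetrised digraph.
\<close>

lemma connected_iff_no_empty_cut:
  assumes "wf_digraph C"
  shows "connected C \<longleftrightarrow> verts C \<noteq> {} \<and>
    (\<forall>W\<subseteq>verts C. W \<noteq> {} \<longrightarrow> (\<forall>e\<in>arcs C. tail C e \<in> W \<longleftrightarrow> head C e \<in> W) \<longrightarrow> W = verts C)"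
    (is "_ \<longleftrightarrow> _ \<and> ?cut")
proof -
  interpret wf_digraph C by fact
  interpret S: pair_wf_digraph "mk_symmetric C" ..
  show ?thesis
  proof (intro iffI conjI)
    assume con: "connected C"
    then show "verts C \<noteq> {}" by (simp add: connected_def strongly_connected_def)
    show ?cut
    proof (intro allI impI equalityI subsetI)
      fix W v assume W: "W \<subseteq> verts C" "W \<noteq> {}" "\<forall>e\<in>arcs C. tail C e \<in> W \<longleftrightarrow> head C e \<in> W" and "v \<in> verts C"
      from W obtain u where "u \<in> W" by auto
      have "u \<rightarrow>\<^sup>*\<^bsub>mk_symmetric C\<^esub> v"
        using con W(1) \<open>u \<in> W\<close> \<open>v \<in> verts C\<close> by (auto simp: connected_def strongly_connected_def)
      then show "v \<in> W"
        by (induction rule: S.reachable_induct) (use \<open>u \<in> W\<close> W(3) in \<open>auto simp: parcs_mk_symmetric\<close>)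
    qed auto
  next
    assume *: "verts C \<noteq> {} \<and> ?cut"
    have "u \<rightarrow>\<^sup>*\<^bsub>mk_symmetric C\<^esub> v" if uv: "u \<in> verts C" "v \<in> verts C" for u v
    proof -
      let ?W = "{v. u \<rightarrow>\<^sup>*\<^bsub>mk_symmetric C\<^esub> v}"
      have "tail C e \<in> ?W \<longleftrightarrow> head C e \<in> ?W" if "e \<in> arcs C" for e
        using that S.reachable_adj_trans[of u "tail C e" "head C e"]
          S.reachable_adj_trans[of u "head C e" "tail C e"]
        by (auto simp: parcs_mk_symmetric)
      moreover have "?W \<subseteq> verts C" using S.reachable_in_verts by auto
      moreover have "u \<in> ?W" using uv by simp
      then have "?W \<noteq> {}" by blast
      ultimately have "?W = verts C" using * by blast
      with uv show ?thesis by auto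
    qed
    with * show "connected C" by (auto simp: connected_def strongly_connected_def)
  qed
qed

text \<open>
  A loop counts twice, as it does in the sum of in-degree and out-degree.
\<close>

definition incidence :: "('a, 'b) pre_digraph \<Rightarrow> 'b \<Rightarrow> 'a \<Rightarrow> int" where
  "incidence C e v = of_bool (tail C e = v) + of_bool (head C e = v)"

lemma degree_conv_incidence:
  assumes "finite (arcs C)"
  shows "int (in_degree C v + out_degree C v) = (\<Sum>e\<in>arcs C. incidence C e v)"
proof -
  have "{e \<in> arcs C. P e} = arcs C \<inter> {e. P e}" for P by auto
  with assms show ?thesis
    by (simp add: incidence_def in_degree_def out_degree_def in_arcs_def out_arcs_def sum.distrib)
qed

lemma walk_incidence:
  assumes "distinct (map fst p)"
  shows "(\<Sum>s\<leftarrow>p. of_bool (step_from C s = v) + of_bool (step_to C s = v))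
       = (\<Sum>e\<in>fst ` set p. incidence C e v)"
proof -
  have "(\<Sum>s\<leftarrow>p. of_bool (step_from C s = v) + of_bool (step_to C s = v))
      = (\<Sum>e\<leftarrow>map fst p. incidence C e v)"
    by (simp add: step_simps incidence_def comp_def if_distrib cong: if_cong)
       (rule arg_cong[of _ _ sum_list], auto)
  also have "\<dots> = (\<Sum>e\<in>set (map fst p). incidence C e v)"
    using assms by (rule sum_list_distinct_conv_sum_set)
  finally show ?thesis by simp
qed

lemma walk_balance:
  assumes "walk_betw (step_from C) (step_to C) x p y"
  shows "(\<Sum>s\<leftarrow>p. of_bool (step_from C s = v) :: int)
       = (\<Sum>s\<leftarrow>p. of_bool (step_to C s = v)) + of_bool (x = v) - of_bool (y = v)"
  using walk_betw_telescope[OF assms, of "\<lambda>u. of_bool (u = v)"] by (simp add: sum_list_subtractf)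

text \<open>
  Take a longest walk without repeated arcs. It cannot be extended at its end \<open>y\<close>, so both units of
  the degree of \<open>y\<close> are used; an even number of used arc ends at \<open>y\<close> forces the walk to be closed.
  A closed walk uses at least two arc ends at each node it visits, hence all of them. So
  no unused arc touches the set of visited nodes, and by connectivity the walk exhausts the
  circuit.
\<close>

lemma circuit_has_traversal:
  assumes "fin_digraph G" "circuit G C"
  shows "\<exists>p. traversal C p"
proof -
  interpret fin_digraph G by fact
  from assms(2) have sub: "subgraph C G" and con: "connected C"
    and deg: "\<And>v. v \<in> verts C \<Longrightarrow> in_degree C v + out_degree C v = 2"
    by (auto simp: circuit_def)
  interpret C: wf_digraph C using sub by (simp add: subgraph_def)
  have fin: "finite (arcs C)" using sub finite_subset[OF _ finite_arcs] by (auto simp: subgraph_def)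
  have inc: "(\<Sum>e\<in>arcs C. incidence C e v) = 2" if "v \<in> verts C" for v
    using degree_conv_incidence[OF fin, of v] deg[OF that] by simp
  have ne: "verts C \<noteq> {}" using con by (simp add: connected_iff_no_empty_cut[OF C.wf_digraph])
  then have "arcs C \<noteq> {}" using inc by fastforce
  then obtain e0 where e0: "e0 \<in> arcs C" by auto
  let ?walk = "walk_betw (step_from C) (step_to C)"
  define P where "P p \<longleftrightarrow> p \<noteq> [] \<and> distinct (map fst p) \<and> fst ` set p \<subseteq> arcs C \<and> (\<exists>x y. ?walk x p y)" for p
  have "P [(e0, True)]" using e0 by (auto simp: P_def)
  moreover have "length p \<le> card (arcs C)" if "P p" for p
    using card_mono[OF fin, of "set (map fst p)"] that by (simp add: P_def distinct_card del: set_map) simp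
  ultimately obtain p where p: "P p" and longest: "\<And>r. P r \<Longrightarrow> length r \<le> length p"
    using ex_has_greatest_nat[of P "[(e0, True)]" length "Suc (card (arcs C))"] by (metis le_imp_less_Suc)
  define A where "A = fst ` set p"
  from p obtain x y where w: "?walk x p y" and dist: "distinct (map fst p)" and A: "A \<subseteq> arcs C" and "p \<noteq> []"
    by (auto simp: P_def A_def)
  define out where "out v = (\<Sum>s\<leftarrow>p. of_bool (step_from C s = v) :: int)" for v
  \<comment> \<open>\<open>out v\<close> counts the departures from \<open>v\<close>; by balance, this determines the used arc ends at \<open>v\<close>.\<close>
  have used: "(\<Sum>e\<in>A. incidence C e v) = 2 * out v - of_bool (x = v) + of_bool (y = v)" for v
    using walk_incidence[OF dist, of C v] walk_balance[OF w, of v]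
    by (simp add: A_def out_def sum_list_addf)
  have total: "(\<Sum>e\<in>arcs C. incidence C e v) =
      (\<Sum>e\<in>A. incidence C e v) + (\<Sum>e\<in>arcs C - A. incidence C e v)" for v
    using sum.subset_diff[OF A fin, of "\<lambda>e. incidence C e v"] by simp
  have ends: "step_from C s \<in> verts C" "step_to C s \<in> verts C" if "s \<in> set p" for s
    using that A by (auto simp: A_def step_simps)
  have "y = step_to C (last p)" using w \<open>p \<noteq> []\<close> by (simp add: walk_betw_conv_nth)
  then have y: "y \<in> verts C" using ends(2)[of "last p"] \<open>p \<noteq> []\<close> by simp
  have "incidence C e y = 0" if e: "e \<in> arcs C - A" for e
  proof (rule ccontr)
    assume "incidence C e y \<noteq> 0"
    then have "tail C e = y \<or> head C e = y" by (auto simp: incidence_def split: if_splits)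
    then have "step_from C (e, tail C e = y) = y" by auto
    then obtain b where "step_from C (e, b) = y" by blast
    then have "P (p @ [(e, b)])"
      using p w e by (auto simp: P_def A_def walk_betw_append)
    then show False using longest by fastforce
  qed
  then have "(\<Sum>e\<in>A. incidence C e y) = 2" using total[of y] inc[OF y] by simp
  then have "2 * out y + 1 = 2 + of_bool (x = y)" using used[of y] by simp
  then have "x = y"
  proof (rule contrapos_pp)
    assume "x \<noteq> y"
    then show "2 * out y + 1 \<noteq> 2 + of_bool (x = y)" by simp presburger
  qed
  define W where "W = step_from C ` set p"
  have W_to: "step_to C s \<in> W" if "s \<in> set p" for s
    unfolding W_def using closed_walk_dst_in_src[OF _ that] w \<open>x = y\<close> by metis
  have Wv: "W \<subseteq> verts C" using ends by (auto simp: W_def)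
  have in_A: "e \<in> A" if e: "e \<in> arcs C" "tail C e \<in> W \<or> head C e \<in> W" for e
  proof (rule ccontr)
    assume "e \<notin> A"
    from e obtain v where v: "v \<in> W" "tail C e = v \<or> head C e = v" by auto
    then obtain s where s: "s \<in> set p" "step_from C s = v" by (auto simp: W_def)
    obtain p1 p2 where "p = p1 @ s # p2" using s(1) by (meson split_list)
    then have "1 \<le> out v"
      unfolding out_def using s(2) by (auto intro!: add_nonneg_nonneg sum_list_nonneg)
    moreover have "incidence C e v \<le> (\<Sum>e\<in>arcs C - A. incidence C e v)"
      using e \<open>e \<notin> A\<close> fin by (intro member_le_sum) (auto simp: incidence_def)
    moreover have "1 \<le> incidence C e v" using v by (auto simp: incidence_def)
    ultimately show False
      using total[of v] used[of v] inc[of v] v Wv \<open>x = y\<close> by auto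
  qed
  have "tail C e \<in> W \<longleftrightarrow> head C e \<in> W" if "e \<in> arcs C" for e
  proof -
    have "tail C e \<in> W \<and> head C e \<in> W" if "e \<in> A"
    proof -
      obtain b where "(e, b) \<in> set p" using \<open>e \<in> A\<close> by (auto simp: A_def)
      then show ?thesis
        using W_to[of "(e, b)"] by (cases b) (force simp: W_def)+
    qed
    with in_A[OF that] show ?thesis by blast
  qed
  moreover have "W \<noteq> {}" using \<open>p \<noteq> []\<close> by (simp add: W_def)
  ultimately have "W = verts C"
    using con Wv connected_iff_no_empty_cut[OF C.wf_digraph] by blast
  then have "A = arcs C" using in_A A by auto
  have "traversal C p"
    unfolding traversal_def
    using dist \<open>A = arcs C\<close> closed_walk_conv_nth[OF \<open>p \<noteq> []\<close>, of "step_from C" "step_to C"] w \<open>x = y\<close>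
    by (auto simp: A_def)
  then show ?thesis ..
qed

text \<open>
  Since no node is left twice, the two passages of a repeated arc must have opposite directions;
  so the second starts where the first arrives and returns to its start. Any further step would
  leave one of the two ends a second time.
\<close>

lemma simple_closed_walk_on_edge:
  assumes w: "walk_betw (step_from G) (step_to G) x q x" and dist: "distinct (map (step_from G) q)"
    and "\<not> distinct (map fst q)"
  obtains e b where "q = [(e, b), (e, \<not> b)]"
proof -
  from assms(3) obtain us a vs ws where "map fst q = us @ [a] @ vs @ [a] @ ws"
    using not_distinct_decomp by blast
  then obtain q1 s q2 s' q3 where q: "q = q1 @ s # q2 @ s' # q3" and "fst s = a" "fst s' = a"
    by (auto simp: map_eq_append_conv map_eq_Cons_conv append_eq_map_conv Cons_eq_map_conv)
  have "s \<noteq> s'" using dist by (auto simp: q)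
  then have "s' = (fst s, \<not> snd s)"
    using \<open>fst s = a\<close> \<open>fst s' = a\<close> by (cases s; cases s') auto
  then have s_s': "step_from G s' = step_to G s" "step_to G s' = step_from G s"
    by (auto simp: step_simps)
  have "q2 = []"
  proof (cases q2)
    case (Cons r q')
    then have "step_from G r = step_from G s'"
      using w s_s' by (auto simp: q walk_betw_append)
    then show ?thesis using dist Cons by (auto simp: q)
  qed simp
  have "q3 @ q1 = []"
  proof (cases "q3 @ q1")
    case (Cons r q')
    have "walk_betw (step_from G) (step_to G) (step_to G s') (q3 @ q1) (step_from G s)"
      using w by (auto simp: q walk_betw_append)
    then have "step_from G r = step_from G s" using s_s' unfolding Cons by auto
    moreover have "r \<in> set (q3 @ q1)" unfolding Cons by simp
    ultimately show ?thesis using dist by (auto simp: q) (metis image_eqI)+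
  qed simp
  show thesis
    using that[of "fst s" "snd s"] \<open>q2 = []\<close> \<open>q3 @ q1 = []\<close> \<open>s' = _\<close> by (simp add: q)
qed

lemma eta_le_num_backward: "traversal C p \<Longrightarrow> eta C \<le> num_backward p"
proof -
  assume "traversal C p"
  then have "eta C \<le> min (num_forward p) (num_backward p)"
    unfolding eta_def by (intro Least_le) auto
  then show ?thesis by simp
qed

text \<open>
  The nodes and arcs of the walk form the circuit. The walk itself is one of its traversals, so the
  number of backward steps bounds \<^const>\<open>eta\<close>.
\<close>

lemma simple_closed_walk_circuit:
  assumes "wf_digraph G" and "q \<noteq> []" and w: "walk_betw (step_from G) (step_to G) x q x"
    and dist: "distinct (map (step_from G) q)" and dist': "distinct (map fst q)"
    and arcs: "fst ` set q \<subseteq> arcs G"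
  obtains C where "circuit G C" "verts C = step_from G ` set q" "eta C \<le> num_backward q"
proof -
  interpret wf_digraph G by fact
  define C where "C = \<lparr>verts = step_from G ` set q, arcs = fst ` set q, tail = tail G, head = head G\<rparr>"
  have C: "step_from C = step_from G" "step_to C = step_to G" "verts C = step_from G ` set q"
    "arcs C = fst ` set q" "tail C = tail G" "head C = head G"
    by (auto simp: C_def step_simps)
  have to: "step_to G s \<in> verts C" if "s \<in> set q" for s
    using closed_walk_dst_in_src[OF w that] by (simp add: C)
  have ends: "tail C e \<in> verts C \<and> head C e \<in> verts C" if "e \<in> arcs C" for e
  proof -
    obtain b where "(e, b) \<in> set q" using \<open>e \<in> arcs C\<close> by (auto simp: C)
    then show ?thesis using to[of "(e, b)"] by (cases b) (force simp: C)+
  qed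
  then have "wf_digraph C" by unfold_locales auto
  have "step_from G s \<in> verts G" if "s \<in> set q" for s
    using that arcs by (auto simp: step_simps)
  then have sub: "subgraph C G"
    using \<open>wf_digraph C\<close> wf_digraph arcs by (auto simp: subgraph_def compatible_def C)
  have "W = verts C" if W: "W \<subseteq> verts C" "W \<noteq> {}" "\<forall>e\<in>arcs C. tail C e \<in> W \<longleftrightarrow> head C e \<in> W" for W
  proof -
    \<comment> \<open>Membership in \<open>W\<close> does not change along a step, hence not along the walk.\<close>
    have "step_from G s \<in> W \<longleftrightarrow> x \<in> W" if s: "s \<in> set q" for s
    proof -
      obtain q1 q2 where q: "q = q1 @ s # q2" using s by (meson split_list)
      then have "walk_betw (step_from G) (step_to G) x q1 (step_from G s)"
        using w by (auto simp: walk_betw_append)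
      then have "(\<Sum>s\<leftarrow>q1. of_bool (step_from G s \<in> W) - of_bool (step_to G s \<in> W))
          = (of_bool (x \<in> W) - of_bool (step_from G s \<in> W) :: int)"
        by (rule walk_betw_telescope)
      also have "map (\<lambda>s. of_bool (step_from G s \<in> W) - of_bool (step_to G s \<in> W) :: int) q1 = map (\<lambda>_. 0) q1"
        using W(3) by (intro map_cong) (auto simp: C q step_simps)
      finally show ?thesis by (auto simp: map_replicate_const sum_list_replicate split: if_splits)
    qed
    then show "W = verts C" using W(1,2) by (auto simp: C)
  qed
  then have "connected C"
    using \<open>q \<noteq> []\<close> by (auto simp: connected_iff_no_empty_cut[OF \<open>wf_digraph C\<close>] C)
  moreover have "in_degree C v + out_degree C v = 2" if v: "v \<in> verts C" for v
  proof -
    have "(\<Sum>s\<leftarrow>q. of_bool (step_from C s = v) :: int) = (\<Sum>u\<leftarrow>map (step_from C) q. of_bool (u = v))"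
      by (simp add: comp_def)
    also have "\<dots> = (\<Sum>u\<in>set (map (step_from C) q). of_bool (u = v))"
      using dist unfolding C by (rule sum_list_distinct_conv_sum_set)
    also have "\<dots> = 1" using v by (simp add: C)
    finally have "(\<Sum>e\<in>arcs C. incidence C e v) = 2"
      using walk_balance[of C x q x v] w walk_incidence[OF dist', of C v]
      by (simp add: C sum_list_addf)
    then show ?thesis
      using degree_conv_incidence[of C v] by (simp add: C)
  qed
  ultimately have "circuit G C" using sub by (simp add: circuit_def)
  moreover have "traversal C q"
    using closed_walk_conv_nth[OF \<open>q \<noteq> []\<close>, of "step_from G" "step_to G"] w dist'
    by (auto simp: traversal_def C)
  ultimately show thesis using that[of C] eta_le_num_backward[of C q] by (simp add: C)
qed

section \<open>Decomposing a circulation into circuits and edges\<close>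

definition steps :: "('a, 'b) pre_digraph \<Rightarrow> ('b \<times> bool) set" where
  "steps G = arcs G \<times> UNIV"

lemma simple_closed_walk_system:
  assumes "wf_digraph G" and "q \<noteq> []" and w: "walk_betw (step_from G) (step_to G) x q x"
    and dist: "distinct (map (step_from G) q)" and "set q \<subseteq> steps G"
  obtains Cs Es where "is_system G (Cs, Es)" "system_value (Cs, Es) \<le> num_backward q"
    "\<And>v. num_containing G (Cs, Es) v = of_bool (v \<in> step_from G ` set q)"
proof (cases "distinct (map fst q)")
  case True
  have "fst ` set q \<subseteq> arcs G" using assms(5) by (fastforce simp: steps_def)
  with assms True obtain C where "circuit G C" "verts C = step_from G ` set q" "eta C \<le> num_backward q"
    using simple_closed_walk_circuit[of G q x] by metis
  then show thesis
    using that[of "{#C#}" "{#}"] by (simp add: is_system_def system_value_def num_containing_def)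
next
  case False
  with simple_closed_walk_on_edge[OF w dist] obtain e b where q: "q = [(e, b), (e, \<not> b)]" .
  then have "e \<in> arcs G" using assms(5) by (simp add: steps_def)
  moreover have "num_backward q = 1" by (cases b) (simp_all add: q num_backward_def)
  moreover have "step_from G ` set q = {tail G e, head G e}" by (auto simp: q)
  ultimately show thesis
    using that[of "{#}" "{#e#}"] by (simp add: is_system_def system_value_def num_containing_def)
qed

definition merge_systems :: "('a, 'b) system \<Rightarrow> ('a, 'b) system \<Rightarrow> ('a, 'b) system" where
  "merge_systems S T = (fst S + fst T, snd S + snd T)"

lemma merge_systems_simps:
  "is_system G (merge_systems S T) \<longleftrightarrow> is_system G S \<and> is_system G T"
  "system_value (merge_systems S T) = system_value S + system_value T"
  "num_containing G (merge_systems S T) v = num_containing G S v + num_containing G T v"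
  by (auto simp: merge_systems_def is_system_def system_value_def num_containing_def split_beta)

text \<open>
  Closed walks that leave no node twice are split off one at a time, each lowering the flow on its
  steps by one unit. The cost \<open>\<Sum>e. f (e, False)\<close> drops by the number of backward steps of the walk,
  and the throughput of each node drops by one exactly if the walk visits it.
\<close>

lemma circulation_decomposition:
  assumes "fin_digraph G"
  assumes "circulation (step_from G) (step_to G) (steps G) (\<lambda>s. int (f s))"
  shows "\<exists>\<S>. is_system G \<S> \<and> system_value \<S> \<le> (\<Sum>e\<in>arcs G. f (e, False)) \<and>
    (\<forall>v. (\<Sum>s\<in>{s \<in> steps G. step_from G s = v}. f s) \<le> num_containing G \<S> v)"
  using assms(2)
proof (induction "\<Sum>s\<in>steps G. f s" arbitrary: f rule: less_induct)
  case (less f)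
  interpret fin_digraph G by fact
  have fin: "finite (steps G)" by (simp add: steps_def)
  show ?case
  proof (cases "\<forall>s\<in>steps G. f s = 0")
    case True
    then show ?thesis
      by (intro exI[of _ "({#}, {#})"]) (simp add: is_system_def system_value_def num_containing_def)
  next
    case False
    then obtain s0 where s0: "s0 \<in> steps G" "0 < f s0" by auto
    obtain x q where q: "q \<noteq> []" "walk_betw (step_from G) (step_to G) x q x"
      "distinct (map (step_from G) q)" "set q \<subseteq> {s \<in> steps G. 0 < f s}"
      using circulation_contains_simple_closed_walk[OF fin less.prems s0] .
    define g where "g s = f s - of_bool (s \<in> set q)" for s
    have f: "f s = g s + of_bool (s \<in> set q)" if "s \<in> steps G" for s
      using q(4) that by (auto simp: g_def)
    have dq: "distinct q" using q(3) by (simp add: distinct_map)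
    have restrict: "(\<Sum>s\<in>A. of_bool (s \<in> set q) * (h s :: int)) = (\<Sum>s\<in>set q. h s)"
      if "set q \<subseteq> A" "finite A" for h A
      using that by (intro sum.mono_neutral_cong_right) auto
    have "circulation (step_from G) (step_to G) (steps G) (\<lambda>s. int (g s))"
      unfolding circulation_def
    proof
      fix \<phi> :: "'a \<Rightarrow> int"
      let ?d = "\<lambda>s. \<phi> (step_from G s) - \<phi> (step_to G s)"
      have "0 = (\<Sum>s\<in>steps G. int (f s) * ?d s)"
        using less.prems by (simp add: circulation_def)
      also have "\<dots> = (\<Sum>s\<in>steps G. int (g s) * ?d s) + (\<Sum>s\<in>steps G. of_bool (s \<in> set q) * ?d s)"
        unfolding sum.distrib[symmetric] by (intro sum.cong refl) (simp add: f distrib_right)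
      also have "(\<Sum>s\<in>steps G. of_bool (s \<in> set q) * ?d s) = (\<Sum>s\<leftarrow>q. ?d s)"
        using q(4) fin dq by (subst restrict) (auto simp: sum_list_distinct_conv_sum_set)
      also have "\<dots> = 0" using walk_betw_telescope[OF q(2), of \<phi>] by simp
      finally show "(\<Sum>s\<in>steps G. int (g s) * ?d s) = 0" by simp
    qed
    moreover have "(\<Sum>s\<in>steps G. g s) < (\<Sum>s\<in>steps G. f s)"
    proof (rule sum_strict_mono_ex1[OF fin])
      show "\<exists>s\<in>steps G. g s < f s"
        using q(1,4) by (intro bexI[of _ "hd q"]) (auto simp: g_def dest: hd_in_set)
    qed (simp add: g_def)
    ultimately obtain T where T: "is_system G T" "system_value T \<le> (\<Sum>e\<in>arcs G. g (e, False))"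
      "\<And>v. (\<Sum>s\<in>{s \<in> steps G. step_from G s = v}. g s) \<le> num_containing G T v"
      using less.hyps[of g] by auto
    obtain Cs Es where S: "is_system G (Cs, Es)" "system_value (Cs, Es) \<le> num_backward q"
      "\<And>v. num_containing G (Cs, Es) v = of_bool (v \<in> step_from G ` set q)"
      using simple_closed_walk_system[OF wf_digraph q(1-3)] q(4) by blast
    have back_eq: "num_backward q = (\<Sum>e\<in>arcs G. of_bool ((e, False) \<in> set q))"
    proof -
      have "num_backward q = card {s \<in> set q. \<not> snd s}"
        using dq by (simp add: num_backward_def flip: distinct_card[OF distinct_filter])
      also have "{s \<in> set q. \<not> snd s} = (\<lambda>e. (e, False)) ` {e \<in> arcs G. (e, False) \<in> set q}"
        using q(4) by (auto simp: steps_def)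
      also have "card \<dots> = card {e \<in> arcs G. (e, False) \<in> set q}"
        by (intro card_image) (auto simp: inj_on_def)
      also have "\<dots> = (\<Sum>e\<in>arcs G. of_bool ((e, False) \<in> set q))"
        by (simp add: Collect_conj_eq)
      finally show ?thesis .
    qed
    have "(\<Sum>e\<in>arcs G. f (e, False)) = (\<Sum>e\<in>arcs G. g (e, False)) + num_backward q"
      unfolding back_eq sum.distrib[symmetric] by (intro sum.cong refl f) (simp add: steps_def)
    moreover have "(\<Sum>s\<in>{s \<in> steps G. step_from G s = v}. f s)
        = (\<Sum>s\<in>{s \<in> steps G. step_from G s = v}. g s) + of_bool (v \<in> step_from G ` set q)" for v
    proof -
      have "(\<Sum>s\<in>{s \<in> steps G. step_from G s = v}. of_bool (s \<in> set q) :: nat)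
          = card {s \<in> set q. step_from G s = v}"
        using q(4) fin by (auto intro!: arg_cong[of _ _ card])
      also have "\<dots> = card (step_from G ` {s \<in> set q. step_from G s = v})"
        using q(3) by (intro card_image[symmetric]) (auto simp: distinct_map inj_on_def)
      also have "g ` {s \<in> set q. g s = v} = (if v \<in> g ` set q then {v} else {})" for g :: "'b \<times> bool \<Rightarrow> 'a"
        by auto
      finally show ?thesis
        by (simp add: f sum.distrib)
    qed
    ultimately show ?thesis
      using T S by (intro exI[of _ "merge_systems T (Cs, Es)"])
        (auto simp: merge_systems_simps intro!: add_mono)
  qed
qed

section \<open>Sink-stable sets as jumps of a potential\<close>

text \<open>
  With \<open>S\<close> empty this says that \<open>\<pi>\<close> grows by 0 or 1 along each arc. A node of \<open>S\<close> forces growth 1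
  on its leaving arcs and growth 0 on its entering arcs, so that it becomes a sink when the arcs of
  growth 1 are reversed.
\<close>

definition sink_potential :: "('a, 'b) pre_digraph \<Rightarrow> 'a set \<Rightarrow> ('a \<Rightarrow> int) \<Rightarrow> bool" where
  "sink_potential G S \<pi> \<longleftrightarrow> (\<forall>e\<in>arcs G.
     \<pi> (tail G e) + of_bool (tail G e \<in> S) \<le> \<pi> (head G e) \<and>
     \<pi> (head G e) + of_bool (head G e \<in> S) \<le> \<pi> (tail G e) + 1)"

lemma sink_potentialD:
  assumes "sink_potential G S \<pi>" "e \<in> arcs G"
  shows "\<pi> (tail G e) + of_bool (tail G e \<in> S) \<le> \<pi> (head G e)"
    "\<pi> (head G e) + of_bool (head G e \<in> S) \<le> \<pi> (tail G e) + 1"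
  using assms by (simp_all add: sink_potential_def)

lemma sink_set_reverse_iff:
  "sink_set (reverse_arcs G X) S \<longleftrightarrow> S \<subseteq> verts G \<and>
     (\<forall>e\<in>arcs G. if e \<in> X then head G e \<notin> S else tail G e \<notin> S)"
  by (auto simp: sink_set_def reverse_arcs_def out_arcs_def)

text \<open>
  A family of disjoint dicuts yields the potential counting the entered sets that contain a node;
  disjointness keeps its growth along an arc at most 1. Conversely, the level sets
  \<open>{v. k \<le> \<pi> v}\<close> of a potential are entered by dicuts, disjoint because \<open>\<pi>\<close> passes at most one
  level along an arc, and together they consist of the arcs where \<open>\<pi>\<close> grows.
\<close>

lemma sink_stable_iff_potential:
  assumes "fin_digraph G"
  shows "sink_stable G S \<longleftrightarrow> S \<subseteq> verts G \<and> (\<exists>\<pi>. sink_potential G S \<pi>)"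
proof
  interpret fin_digraph G by fact
  assume "sink_stable G S"
  then obtain F where F: "\<And>X. X \<in> F \<Longrightarrow> dicut G X" and disj: "pairwise disjnt F"
    and sink: "sink_set (reverse_arcs G (\<Union>F)) S" by (auto simp: sink_stable_def)
  have "F \<subseteq> Pow (arcs G)" using F by (auto simp: dicut_def)
  then have "finite F" by (rule finite_subset) simp
  define enters where "enters X Z \<longleftrightarrow> X = {e \<in> arcs G. tail G e \<notin> Z \<and> head G e \<in> Z} \<and>
        \<not> (\<exists>e \<in> arcs G. tail G e \<in> Z \<and> head G e \<notin> Z)" for X Z
  have "\<exists>Z. enters X Z" if "X \<in> F" for X
    using F[OF that] by (auto simp: dicut_def enters_def)
  then obtain Z where Z: "\<And>X. X \<in> F \<Longrightarrow> enters X (Z X)"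
    by metis
  define \<pi> where "\<pi> v = (\<Sum>X\<in>F. of_bool (v \<in> Z X) :: int)" for v
  have "\<pi> (head G e) = \<pi> (tail G e) + of_bool (e \<in> \<Union>F)" if e: "e \<in> arcs G" for e
  proof -
    have "of_bool (head G e \<in> Z X) = (of_bool (tail G e \<in> Z X) + of_bool (e \<in> X) :: int)"
      if "X \<in> F" for X
    proof -
      have "e \<in> X \<longleftrightarrow> tail G e \<notin> Z X \<and> head G e \<in> Z X" "tail G e \<in> Z X \<longrightarrow> head G e \<in> Z X"
        using Z[OF that] e unfolding enters_def by blast+
      then show ?thesis by simp
    qed
    then have "\<pi> (head G e) = (\<Sum>X\<in>F. of_bool (tail G e \<in> Z X) + of_bool (e \<in> X))"
      unfolding \<pi>_def by simp
    also have "\<dots> = \<pi> (tail G e) + (\<Sum>X\<in>F. of_bool (e \<in> X))"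
      by (simp add: \<pi>_def sum.distrib)
    also have "(\<Sum>X\<in>F. of_bool (e \<in> X) :: int) = of_bool (e \<in> \<Union>F)"
    proof (cases "e \<in> \<Union>F")
      case True
      then obtain X where "X \<in> F" "e \<in> X" by auto
      then have "(\<Sum>X\<in>F. of_bool (e \<in> X) :: int) = (\<Sum>Y\<in>F. of_bool (Y = X))"
        using disj by (intro sum.cong refl) (auto simp: pairwise_def disjnt_iff)
      with True \<open>X \<in> F\<close> \<open>finite F\<close> show ?thesis by simp
    qed auto
    finally show ?thesis .
  qed
  then have "sink_potential G S \<pi>"
    using sink by (auto simp: sink_potential_def sink_set_reverse_iff)
  then show "S \<subseteq> verts G \<and> (\<exists>\<pi>. sink_potential G S \<pi>)"
    using sink by (auto simp: sink_set_reverse_iff)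
next
  assume "S \<subseteq> verts G \<and> (\<exists>\<pi>. sink_potential G S \<pi>)"
  then obtain \<pi> where S: "S \<subseteq> verts G" and \<pi>: "sink_potential G S \<pi>" by auto
  interpret fin_digraph G by fact
  define cut where "cut k = {e \<in> arcs G. \<pi> (tail G e) < k \<and> k \<le> \<pi> (head G e)}" for k
  have mono: "\<pi> (tail G e) \<le> \<pi> (head G e)" "\<pi> (head G e) \<le> \<pi> (tail G e) + 1" if "e \<in> arcs G" for e
    using sink_potentialD[OF \<pi> that] by (simp_all add: of_bool_def split: if_splits)
  have "dicut G (cut k)" for k
    unfolding dicut_def
    by (rule exI[of _ "{v \<in> verts G. k \<le> \<pi> v}"]) (use mono(1) in \<open>force simp: cut_def\<close>)
  moreover have "pairwise disjnt (range cut)"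
    using mono(2) by (fastforce simp: pairwise_def disjnt_iff cut_def)
  moreover have "\<Union>(range cut) = {e \<in> arcs G. \<pi> (tail G e) < \<pi> (head G e)}"
    by (force simp: cut_def)
  then have "sink_set (reverse_arcs G (\<Union>(range cut))) S"
    unfolding sink_set_reverse_iff using S sink_potentialD[OF \<pi>] by fastforce
  ultimately show "sink_stable G S"
    unfolding sink_stable_def by (intro exI[of _ "range cut"]) auto
qed

lemma sink_stable_mono:
  assumes "sink_stable G S" "T \<subseteq> S"
  shows "sink_stable G T"
proof -
  obtain F where F: "\<forall>X\<in>F. dicut G X" "pairwise disjnt F" "sink_set (reverse_arcs G (\<Union>F)) S"
    using assms(1) unfolding sink_stable_def by blast
  have "sink_set (reverse_arcs G (\<Union>F)) T"
    using F(3) assms(2) by (auto simp: sink_set_def)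
  with F(1,2) show ?thesis unfolding sink_stable_def by blast
qed

section \<open>Weak duality\<close>

lemma card_sink_stable_edge_le:
  assumes "sink_potential G S \<pi>" "e \<in> arcs G"
  shows "card (S \<inter> {tail G e, head G e}) \<le> 1"
proof -
  have "\<not> (tail G e \<in> S \<and> head G e \<in> S)"
    using sink_potentialD[OF assms] by (auto simp: of_bool_def)
  then have "card (S \<inter> {tail G e, head G e}) \<le> card {if tail G e \<in> S then tail G e else head G e}"
    by (intro card_mono) auto
  then show ?thesis by simp
qed

lemma eta_attained:
  assumes "traversal C p0"
  shows "\<exists>p. traversal C p \<and> eta C = min (num_forward p) (num_backward p)"
proof -
  have "\<exists>k p. traversal C p \<and> k = min (num_forward p) (num_backward p)" using assms by blast
  from LeastI_ex[OF this] show ?thesis unfolding eta_def .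
qed

text \<open>
  Summing the potential inequalities over the steps of a traversal cancels \<open>\<pi>\<close> and bounds the nodes in
  \<open>S\<close> by the number of backward steps. Reading the same steps in the opposite direction bounds them by
  the number of forward steps, because every node is also an arrival point.
\<close>

lemma card_sink_stable_circuit_le:
  assumes "fin_digraph G" and \<pi>: "sink_potential G S \<pi>" and C: "circuit G C"
  shows "card (S \<inter> verts C) \<le> eta C"
proof -
  obtain p0 where "traversal C p0" using circuit_has_traversal[OF assms(1) C] by blast
  then obtain p where p: "traversal C p" and eta: "eta C = min (num_forward p) (num_backward p)"
    using eta_attained by blast
  from C have sub: "subgraph C G" and con: "connected C"
    and deg: "\<And>v. v \<in> verts C \<Longrightarrow> in_degree C v + out_degree C v = 2"
    by (auto simp: circuit_def)
  have GC: "tail C = tail G" "head C = head G" using sub by (auto simp: subgraph_def compatible_def)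
  have arcs: "fst ` set p = arcs C" "arcs C \<subseteq> arcs G"
    using p sub by (auto simp: traversal_def subgraph_def)
  have inc: "\<exists>s\<in>set p. step_from C s = v \<or> step_to C s = v" if v: "v \<in> verts C" for v
  proof -
    have "in_arcs C v \<noteq> {} \<or> out_arcs C v \<noteq> {}"
      using deg[OF v] by (auto simp: in_degree_def out_degree_def)
    then obtain e where "e \<in> arcs C" and e: "tail C e = v \<or> head C e = v" by fastforce
    then obtain b where "(e, b) \<in> set p" using arcs(1) by force
    with e show ?thesis by (intro bexI[of _ "(e, b)"]) (cases b; auto)
  qed
  have "verts C \<noteq> {}" using sub con by (simp add: subgraph_def connected_iff_no_empty_cut)
  with inc have "p \<noteq> []" by auto
  with p obtain x where w: "walk_betw (step_from C) (step_to C) x p x"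
    using closed_walk_conv_nth[of p "step_from C" "step_to C"]
    by (auto simp: traversal_def)
  have sub_from: "verts C \<subseteq> step_from C ` set p"
    using inc closed_walk_dst_in_src[OF w] by blast
  have "int (card (S \<inter> verts C)) \<le> (\<Sum>s\<leftarrow>p. of_bool (step_from C s \<in> S))"
  proof -
    have "card (S \<inter> verts C) \<le> card (step_from C ` {s \<in> set p. step_from C s \<in> S})"
      using sub_from by (intro card_mono) auto
    also have "\<dots> \<le> card {s \<in> set p. step_from C s \<in> S}" by (intro card_image_le) simp
    also have "\<dots> \<le> length (filter (\<lambda>s. step_from C s \<in> S) p)"
      using card_length[of "filter (\<lambda>s. step_from C s \<in> S) p"] by simp
    also have "int (length (filter (\<lambda>s. step_from C s \<in> S) p)) = (\<Sum>s\<leftarrow>p. of_bool (step_from C s \<in> S))"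
      by (induction p) auto
    finally show ?thesis by simp
  qed
  moreover have to_from: "(\<Sum>s\<leftarrow>p. \<phi> (step_from C s)) = (\<Sum>s\<leftarrow>p. \<phi> (step_to C s))" for \<phi> :: "'a \<Rightarrow> int"
    using walk_betw_telescope[OF w, of \<phi>] by (simp add: sum_list_subtractf)
  have pot: "\<pi> (step_from C s) + of_bool (step_from C s \<in> S) \<le> \<pi> (step_to C s) + of_bool (\<not> snd s)"
    "\<pi> (step_to C s) + of_bool (step_to C s \<in> S) \<le> \<pi> (step_from C s) + of_bool (snd s)" if "s \<in> set p" for s
  proof -
    have "fst s \<in> arcs G" using that arcs by blast
    from sink_potentialD[OF \<pi> this]
    show "\<pi> (step_from C s) + of_bool (step_from C s \<in> S) \<le> \<pi> (step_to C s) + of_bool (\<not> snd s)"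
      "\<pi> (step_to C s) + of_bool (step_to C s \<in> S) \<le> \<pi> (step_from C s) + of_bool (snd s)"
      by (cases "snd s"; simp add: step_simps GC)+
  qed
  have "(\<Sum>s\<leftarrow>p. of_bool (step_from C s \<in> S) :: int) \<le> num_backward p"
  proof -
    have "(\<Sum>s\<leftarrow>p. \<pi> (step_from C s) + of_bool (step_from C s \<in> S))
        \<le> (\<Sum>s\<leftarrow>p. \<pi> (step_to C s) + of_bool (\<not> snd s))"
      using pot(1) by (rule sum_list_mono)
    moreover have "(\<Sum>s\<leftarrow>p. of_bool (\<not> snd s) :: int) = num_backward p"
      unfolding num_backward_def by (induction p) auto
    ultimately show ?thesis by (simp add: sum_list_addf to_from[of \<pi>])
  qed
  moreover have "(\<Sum>s\<leftarrow>p. of_bool (step_from C s \<in> S) :: int) \<le> num_forward p"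
  proof -
    have "(\<Sum>s\<leftarrow>p. \<pi> (step_to C s) + of_bool (step_to C s \<in> S))
        \<le> (\<Sum>s\<leftarrow>p. \<pi> (step_from C s) + of_bool (snd s))"
      using pot(2) by (rule sum_list_mono)
    moreover have "(\<Sum>s\<leftarrow>p. of_bool (snd s) :: int) = num_forward p"
      unfolding num_forward_def by (induction p) auto
    ultimately show ?thesis by (simp add: sum_list_addf to_from[of \<pi>] to_from[of "\<lambda>v. of_bool (v \<in> S)"])
  qed
  ultimately show ?thesis using eta by simp
qed

lemma sum_size_filter_mset:
  assumes "finite S"
  shows "(\<Sum>v\<in>S. size {#x \<in># M. v \<in> V x#}) = (\<Sum>x\<in>#M. card (S \<inter> V x))"
proof (induction M)
  case (add x M)
  have "(\<Sum>v\<in>S. size {#y \<in># add_mset x M. v \<in> V y#}) = (\<Sum>v\<in>S. size {#y \<in># M. v \<in> V y#} + of_bool (v \<in> V x))"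
    by (intro sum.cong) auto
  with add assms show ?case by (simp add: sum.distrib)
qed simp

lemma sum_num_containing:
  assumes "finite S"
  shows "(\<Sum>v\<in>S. num_containing G (Cs, Es) v)
       = (\<Sum>C\<in>#Cs. card (S \<inter> verts C)) + (\<Sum>e\<in>#Es. card (S \<inter> {tail G e, head G e}))"
  using sum_size_filter_mset[OF assms, where M = Cs and V = verts]
    sum_size_filter_mset[OF assms, where M = Es and V = "\<lambda>e. {tail G e, head G e}"]
  by (simp add: num_containing_def sum.distrib)

lemma weak_duality:
  assumes "fin_digraph G" "sink_stable G S" "is_system G \<S>" "covers_weight G \<S> w"
  shows "(\<Sum>v\<in>S. w v) \<le> system_value \<S>"
proof -
  interpret fin_digraph G by fact
  obtain Cs Es where \<S>: "\<S> = (Cs, Es)" by fastforce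
  obtain \<pi> where S: "S \<subseteq> verts G" and \<pi>: "sink_potential G S \<pi>"
    using assms by (auto simp: sink_stable_iff_potential)
  have "(\<Sum>v\<in>S. w v) \<le> (\<Sum>v\<in>S. num_containing G \<S> v)"
    using assms(4) S by (intro sum_mono) (auto simp: covers_weight_def)
  also have "\<dots> = (\<Sum>C\<in>#Cs. card (S \<inter> verts C)) + (\<Sum>e\<in>#Es. card (S \<inter> {tail G e, head G e}))"
    unfolding \<S> using finite_subset[OF S] by (intro sum_num_containing) auto
  also have "\<dots> \<le> (\<Sum>C\<in>#Cs. eta C) + (\<Sum>e\<in>#Es. 1)"
    using assms(3) card_sink_stable_circuit_le[OF assms(1) \<pi>] card_sink_stable_edge_le[OF \<pi>]
    by (intro add_mono sum_mset_mono) (auto simp: \<S> is_system_def)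
  finally show ?thesis by (simp add: \<S> system_value_def)
qed

section \<open>Strong duality\<close>

text \<open>
  The split digraph has the nodes \<open>(v, False)\<close> and \<open>(v, True)\<close> for each node \<open>v\<close>. A flow unit
  arrives at \<open>v\<close> in the copy \<open>(v, False)\<close>, uses the arc \<open>Inr v\<close> to \<open>(v, True)\<close>, whose lower bound is
  \<open>w v\<close>, and departs from there by a step \<open>Inl s\<close>, which costs 1 if it is backward. In an optimal
  potential \<open>p\<close>, the values of the two copies of \<open>v\<close> differ by 0 or 1, and the nodes where they
  differ form the sink-stable set.
\<close>

lemma strong_duality:
  fixes G :: "('a, 'b) pre_digraph" and w :: "'a \<Rightarrow> nat"
  assumes "fin_digraph G" "no_isolated_nodes G"
  obtains S \<S> where "sink_stable G S" "is_system G \<S>" "covers_weight G \<S> w"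
    "system_value \<S> \<le> (\<Sum>v\<in>S. w v)"
proof -
  interpret fin_digraph G by fact
  define E :: "('b \<times> bool + 'a) set" where "E = steps G <+> verts G"
  define t where "t = case_sum (\<lambda>s. (step_from G s, True)) (\<lambda>v. (v, False))"
  define h where "h = case_sum (\<lambda>s. (step_to G s, False)) (\<lambda>v. (v, True))"
  define c :: "'b \<times> bool + 'a \<Rightarrow> int" where "c = case_sum (\<lambda>s. of_bool (\<not> snd s)) (\<lambda>v. 0)"
  define l :: "'b \<times> bool + 'a \<Rightarrow> int" where "l = case_sum (\<lambda>s. 0) (\<lambda>v. int (w v))"
  have fin: "finite (steps G)" "finite E" by (auto simp: steps_def E_def)
  have inE: "Inl s \<in> E \<longleftrightarrow> s \<in> steps G" "Inr v \<in> E \<longleftrightarrow> v \<in> verts G"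
    "(e, b) \<in> steps G \<longleftrightarrow> e \<in> arcs G" for s v e b
    by (auto simp: E_def steps_def)
  have sumE: "(\<Sum>e\<in>E. g e) = (\<Sum>s\<in>steps G. g (Inl s)) + (\<Sum>v\<in>verts G. g (Inr v))" for g :: "_ \<Rightarrow> int"
    unfolding E_def using fin by (simp add: sum.Plus)
  have sum_steps: "(\<Sum>s\<in>steps G. g s) = (\<Sum>e\<in>arcs G. g (e, True) + g (e, False))" for g :: "_ \<Rightarrow> int"
    unfolding steps_def by (simp add: sum.cartesian_product' UNIV_bool add.commute)
  \<comment> \<open>A feasible circulation passes every arc \<open>k\<close> times to and fro. Each node has an incident arc,
    so its throughput is at least \<open>k\<close>, which bounds every \<open>w v\<close>.\<close>
  define k where "k = int (\<Sum>v\<in>verts G. w v)"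
  have "0 \<le> k" unfolding k_def by (rule of_nat_0_le_iff)
  define f0 :: "'b \<times> bool + 'a \<Rightarrow> int" where "f0 = case_sum (\<lambda>s. k) (\<lambda>v. k * (\<Sum>e\<in>arcs G. incidence G e v))"
  have f0_circ: "circulation t h E f0"
    unfolding circulation_def
  proof
    fix \<phi> :: "'a \<times> bool \<Rightarrow> int"
    let ?d = "\<lambda>v. \<phi> (v, False) - \<phi> (v, True)"
    have "(\<Sum>v\<in>verts G. (\<Sum>e\<in>arcs G. incidence G e v) * ?d v)
        = (\<Sum>e\<in>arcs G. \<Sum>v\<in>verts G. incidence G e v * ?d v)"
      unfolding sum_distrib_right by (rule sum.swap)
    also have "\<dots> = (\<Sum>e\<in>arcs G. ?d (tail G e) + ?d (head G e))"
    proof (intro sum.cong refl)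
      fix e assume e: "e \<in> arcs G"
      have "(\<Sum>v\<in>verts G. incidence G e v * ?d v) =
          (\<Sum>v\<in>verts G. if tail G e = v then ?d v else 0) + (\<Sum>v\<in>verts G. if head G e = v then ?d v else 0)"
        unfolding sum.distrib[symmetric] by (intro sum.cong) (auto simp: incidence_def)
      then show "(\<Sum>v\<in>verts G. incidence G e v * ?d v) = ?d (tail G e) + ?d (head G e)"
        using e by simp
    qed
    finally have *: "(\<Sum>v\<in>verts G. k * (\<Sum>e\<in>arcs G. incidence G e v) * ?d v)
        = k * (\<Sum>e\<in>arcs G. ?d (tail G e) + ?d (head G e))"
      by (simp add: mult.assoc flip: sum_distrib_left)
    let ?D = "\<lambda>e. (\<phi> (tail G e, True) - \<phi> (head G e, False)) + (\<phi> (head G e, True) - \<phi> (tail G e, False))"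
    have "(\<Sum>e\<in>E. f0 e * (\<phi> (t e) - \<phi> (h e)))
        = (\<Sum>e\<in>arcs G. k * ?D e) + (\<Sum>v\<in>verts G. k * (\<Sum>e\<in>arcs G. incidence G e v) * ?d v)"
      unfolding sumE sum_steps by (intro arg_cong2[where f = "(+)"] sum.cong refl)
        (simp_all add: f0_def t_def h_def distrib_left)
    also have "\<dots> = k * ((\<Sum>e\<in>arcs G. ?D e) + (\<Sum>e\<in>arcs G. ?d (tail G e) + ?d (head G e)))"
      unfolding * by (simp only: distrib_left sum_distrib_left)
    also have "(\<Sum>e\<in>arcs G. ?D e) + (\<Sum>e\<in>arcs G. ?d (tail G e) + ?d (head G e)) = 0"
      unfolding sum.distrib[symmetric] by (intro sum.neutral) auto
    finally show "(\<Sum>e\<in>E. f0 e * (\<phi> (t e) - \<phi> (h e))) = 0" by simp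
  qed
  have f0_ge: "l e \<le> f0 e" if "e \<in> E" for e
  proof (cases e)
    case (Inl s)
    then show ?thesis using \<open>0 \<le> k\<close> by (simp add: l_def f0_def)
  next
    case (Inr v)
    with that have v: "v \<in> verts G" by (auto simp: E_def)
    then obtain a where a: "a \<in> arcs G" "v = tail G a \<or> v = head G a"
      using assms(2) by (auto simp: no_isolated_nodes_def)
    then have "1 \<le> incidence G a v" by (auto simp: incidence_def)
    also have "\<dots> \<le> (\<Sum>e\<in>arcs G. incidence G e v)"
      using a by (intro member_le_sum) (auto simp: incidence_def)
    finally have "k * 1 \<le> k * (\<Sum>e\<in>arcs G. incidence G e v)"
      using \<open>0 \<le> k\<close> by (intro mult_left_mono)
    moreover have "int (w v) \<le> k"
      unfolding k_def of_nat_le_iff using v by (intro member_le_sum) auto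
    ultimately show ?thesis by (simp add: l_def f0_def Inr)
  qed
  have c0: "0 \<le> c e" and l0: "0 \<le> l e" if "e \<in> E" for e
    by (simp_all add: c_def l_def split: sum.split)
  obtain f \<pi> where f: "circulation t h E f" "\<And>e. e \<in> E \<Longrightarrow> l e \<le> f e"
    and \<pi>: "\<And>e. e \<in> E \<Longrightarrow> \<pi> (t e) - \<pi> (h e) \<le> c e"
    and opt: "(\<Sum>e\<in>E. f e * c e) = (\<Sum>e\<in>E. l e * (c e - (\<pi> (t e) - \<pi> (h e))))"
    by (rule min_cost_circulation_duality[OF fin(2) c0 l0 f0_circ f0_ge]) (assumption | rule that)+

  define p where "p v = \<pi> (v, False)" for v
  define p' where "p' v = \<pi> (v, True)" for v
  have arc: "p' (tail G e) \<le> p (head G e)" "p' (head G e) \<le> p (tail G e) + 1" if "e \<in> arcs G" for e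
    using \<pi>[of "Inl (e, True)"] \<pi>[of "Inl (e, False)"] that
    by (simp_all add: inE t_def h_def c_def p_def p'_def diff_le_eq add.commute)
  have jump: "p v \<le> p' v" if "v \<in> verts G" for v
    using \<pi>[of "Inr v"] that by (simp add: inE t_def h_def c_def p_def p'_def)
  \<comment> \<open>Going once along an incident arc and back raises the potential by at most 1 in total.\<close>
  have jump1: "p' v \<le> p v + 1" if v: "v \<in> verts G" for v
  proof -
    obtain e where e: "e \<in> arcs G" "v = tail G e \<or> v = head G e"
      using assms(2) v by (auto simp: no_isolated_nodes_def)
    then show ?thesis
      using arc[OF e(1)] jump[of "tail G e"] jump[of "head G e"] by auto
  qed
  define S where "S = {v \<in> verts G. p v < p' v}"
  have p': "p' v = p v + of_bool (v \<in> S)" if "v \<in> verts G" for v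
    using jump[OF that] jump1[OF that] that by (auto simp: S_def)
  have "sink_potential G S p"
    using arc by (auto simp: sink_potential_def simp flip: p')
  then have "sink_stable G S"
    using sink_stable_iff_potential[OF assms(1)] by (auto simp: S_def)

  define fs where "fs s = nat (f (Inl s))" for s
  have fs: "int (fs s) = f (Inl s)" if "s \<in> steps G" for s
    using f(2)[of "Inl s"] that by (simp add: fs_def l_def inE)
  have circ: "(\<Sum>s\<in>steps G. int (fs s) * (\<phi> (step_from G s, True) - \<phi> (step_to G s, False)))
      + (\<Sum>v\<in>verts G. f (Inr v) * (\<phi> (v, False) - \<phi> (v, True))) = 0" for \<phi> :: "'a \<times> bool \<Rightarrow> int"
    using f(1)[unfolded circulation_def, rule_format, of \<phi>]
    unfolding sumE by (simp add: t_def h_def fs)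
  have "circulation (step_from G) (step_to G) (steps G) (\<lambda>s. int (fs s))"
    unfolding circulation_def
  proof
    fix \<phi> :: "'a \<Rightarrow> int"
    show "(\<Sum>s\<in>steps G. int (fs s) * (\<phi> (step_from G s) - \<phi> (step_to G s))) = 0"
      using circ[of "\<lambda>u. \<phi> (fst u)"] by simp
  qed
  then obtain \<S> where \<S>: "is_system G \<S>" "system_value \<S> \<le> (\<Sum>e\<in>arcs G. fs (e, False))"
    "\<And>v. (\<Sum>s\<in>{s \<in> steps G. step_from G s = v}. fs s) \<le> num_containing G \<S> v"
    using circulation_decomposition[OF assms(1)] by blast
  \<comment> \<open>Conservation at \<open>(v, True)\<close>: the departures from \<open>v\<close> carry the flow of \<open>Inr v\<close>, at least \<open>w v\<close>.\<close>
  have "covers_weight G \<S> w"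
    unfolding covers_weight_def
  proof
    fix v assume v: "v \<in> verts G"
    have "(\<Sum>u\<in>verts G. f (Inr u) * (0 - of_bool (u = v))) = - f (Inr v)"
      using v by (simp add: sum_negf)
    moreover have "(\<Sum>s\<in>steps G. int (fs s) * of_bool (step_from G s = v))
        = int (\<Sum>s\<in>{s \<in> steps G. step_from G s = v}. fs s)"
      using fin(1) by (simp add: Collect_conj_eq)
    ultimately have "int (\<Sum>s\<in>{s \<in> steps G. step_from G s = v}. fs s) = f (Inr v)"
      using circ[of "\<lambda>u. of_bool (u = (v, True))"] by simp
    moreover have "int (w v) \<le> f (Inr v)"
      using f(2)[of "Inr v"] v by (simp add: l_def inE)
    ultimately show "w v \<le> num_containing G \<S> v"
      using \<S>(3)[of v] by linarith
  qed
  moreover have "system_value \<S> \<le> (\<Sum>v\<in>S. w v)"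
  proof -
    have "int (\<Sum>e\<in>arcs G. fs (e, False)) = (\<Sum>e\<in>E. f e * c e)"
      unfolding sumE sum_steps by (simp add: c_def fs inE)
    also have "\<dots> = (\<Sum>v\<in>verts G. int (w v) * (p' v - p v))"
      unfolding opt sumE by (simp add: l_def c_def t_def h_def p_def p'_def)
    also have "\<dots> = (\<Sum>v\<in>verts G. int (w v) * of_bool (v \<in> S))"
      by (intro sum.cong) (auto simp: p')
    also have "\<dots> = int (\<Sum>v\<in>S. w v)"
      by (simp add: S_def Collect_conj_eq Int_absorb1)
    finally show ?thesis using \<S>(2) by linarith
  qed
  ultimately show thesis using that \<open>sink_stable G S\<close> \<S>(1) by blast
qed

lemma maximum_eq_minimumI:
  assumes "\<And>x y. x \<in> A \<Longrightarrow> y \<in> B \<Longrightarrow> x \<le> y" and "a \<in> A" "b \<in> B" "b \<le> a"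
  shows "\<exists>m. is_maximum A m \<and> is_minimum B m"
proof -
  have "a = b" using assms by (simp add: order_antisym)
  with assms show ?thesis unfolding is_maximum_def is_minimum_def by blast
qed

theorem theorem4p8:
  fixes D :: "('a, 'b) pre_digraph" and w :: "'a \<Rightarrow> nat"
  assumes "fin_digraph D" and "no_isolated_nodes D"
  shows "(\<exists>m. is_maximum {(\<Sum>v\<in>S. w v) | S. sink_stable D S} m \<and>
              is_minimum {system_value \<S> | \<S>. is_system D \<S> \<and> covers_weight D \<S> w} m) \<and>
         (\<forall>U \<subseteq> verts D.
           \<exists>m. is_maximum {card S | S. S \<subseteq> U \<and> sink_stable D S} m \<and>
               is_minimum {system_value \<S> | \<S>. is_system D \<S> \<and> covers_set D \<S> U} m)"
proof (intro conjI allI impI)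
  obtain S \<S> where "sink_stable D S" "is_system D \<S>" "covers_weight D \<S> w" "system_value \<S> \<le> (\<Sum>v\<in>S. w v)"
    using strong_duality[OF assms] .
  then show "\<exists>m. is_maximum {(\<Sum>v\<in>S. w v) | S. sink_stable D S} m \<and>
              is_minimum {system_value \<S> | \<S>. is_system D \<S> \<and> covers_weight D \<S> w} m"
    by (intro maximum_eq_minimumI[where a = "\<Sum>v\<in>S. w v" and b = "system_value \<S>"])
       (use weak_duality[OF assms(1)] in blast)+
next
  fix U assume U: "U \<subseteq> verts D"
  interpret fin_digraph D by fact
  let ?w = "\<lambda>v. of_bool (v \<in> U) :: nat"
  have w: "(\<Sum>v\<in>S. ?w v) = card (S \<inter> U)" if "sink_stable D S" for S
  proof -
    have "S \<subseteq> verts D" using that by (simp add: sink_stable_iff_potential[OF assms(1)])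
    then have "finite S" by (rule finite_subset) simp
    then show ?thesis by simp
  qed
  have cov: "covers_set D \<S> U \<longleftrightarrow> covers_weight D \<S> ?w" for \<S>
    using U by (auto simp: covers_set_def covers_weight_def)
  have weak: "card S \<le> system_value \<S>"
    if "S \<subseteq> U" "sink_stable D S" "is_system D \<S>" "covers_set D \<S> U" for S \<S>
    using weak_duality[OF assms(1) that(2,3), of ?w] that w[OF that(2)] cov[of \<S>] by (simp add: Int_absorb2)
  obtain S \<S> where S: "sink_stable D S" "is_system D \<S>" "covers_weight D \<S> ?w" "system_value \<S> \<le> (\<Sum>v\<in>S. ?w v)"
    using strong_duality[OF assms] .
  have "sink_stable D (S \<inter> U)"
    using S(1) by (rule sink_stable_mono) simp
  then have "card (S \<inter> U) \<in> {card S | S. S \<subseteq> U \<and> sink_stable D S}" by blast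
  moreover have "system_value \<S> \<in> {system_value \<S> | \<S>. is_system D \<S> \<and> covers_set D \<S> U}"
    using S(2,3) cov by blast
  moreover have "system_value \<S> \<le> card (S \<inter> U)"
    using S(4) w[OF S(1)] by simp
  moreover have "x \<le> y" if "x \<in> {card S | S. S \<subseteq> U \<and> sink_stable D S}"
    "y \<in> {system_value \<S> | \<S>. is_system D \<S> \<and> covers_set D \<S> U}" for x y
    using that weak by blast
  ultimately show "\<exists>m. is_maximum {card S | S. S \<subseteq> U \<and> sink_stable D S} m \<and>
               is_minimum {system_value \<S> | \<S>. is_system D \<S> \<and> covers_set D \<S> U} m"
    by (rule maximum_eq_minimumI[rotated])
qed

end
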